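(* For every integer $k\geq 1$, the hypercube $Q_{2^k}$ has a Hamiltonian cycle whose edge set is a fundamental set for $Q_{2^k}$.
   Context: $Q_n$ is the $n$-dimensional hypercube: its vertex set is the set of subsets of $\{1,2,\ldots,n\}$, and two vertices $x,y$ are adjacent iff $|x\,\Delta\, y|=1$. A fundamental set of edges of a graph $G$ is a subset of $E(G)$ whose translates under some subgroup of the automorphism group $\mathrm{Aut}(G)$ partition $E(G)$. *)

theory Defs
  imports "HOL-Algebra.Bij" "HOL-Library.Disjoint_Sets"
begin

record 'a ugraph =
  verts :: "'a set"
  edges :: "'a set set"

definition simple_graph :: "'a ugraph \<Rightarrow> bool" where
  "simple_graph G \<longleftrightarrow> (\<forall>e\<in>edges G. e \<subseteq> verts G \<and> card e = 2)"

definition hypercube :: "nat \<Rightarrow> nat set ugraph" where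
  "hypercube n =
     \<lparr>verts = Pow {1..n},
      edges = {{x, y} | x y. x \<in> Pow {1..n} \<and> y \<in> Pow {1..n} \<and> card (sym_diff x y) = 1}\<rparr>"

lemma simple_graph_hypercube: "simple_graph (hypercube n)"
proof -
  have "card {x, y} = 2" if "card (sym_diff x y) = 1" for x y :: "nat set"
    using that by (cases "x = y") simp_all
  then show ?thesis
    by (fastforce simp: simple_graph_def hypercube_def)
qed

definition graph_automorphisms :: "'a ugraph \<Rightarrow> ('a \<Rightarrow> 'a) set" where
  "graph_automorphisms G =
     {f \<in> Bij (verts G). \<forall>x\<in>verts G. \<forall>y\<in>verts G. {f x, f y} \<in> edges G \<longleftrightarrow> {x, y} \<in> edges G}"

definition Aut_graph :: "'a ugraph \<Rightarrow> ('a \<Rightarrow> 'a) monoid" where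
  "Aut_graph G = BijGroup (verts G) \<lparr>carrier := graph_automorphisms G\<rparr>"

lemma subgroup_graph_automorphisms:
  "subgroup (graph_automorphisms G) (BijGroup (verts G))"
proof (rule subgroup.intro)
  show "graph_automorphisms G \<subseteq> carrier (BijGroup (verts G))"
    by (auto simp: graph_automorphisms_def BijGroup_def)
next
  fix f g assume fg: "f \<in> graph_automorphisms G" "g \<in> graph_automorphisms G"
  then have "f \<in> Bij (verts G)" "g \<in> Bij (verts G)"
    by (auto simp: graph_automorphisms_def)
  moreover from this have "g x \<in> verts G" if "x \<in> verts G" for x
    using that Bij_imp_funcset by blast
  ultimately show "f \<otimes>\<^bsub>BijGroup (verts G)\<^esub> g \<in> graph_automorphisms G"
    using fg by (simp add: graph_automorphisms_def BijGroup_def compose_Bij compose_eq)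
next
  show "\<one>\<^bsub>BijGroup (verts G)\<^esub> \<in> graph_automorphisms G"
    by (simp add: graph_automorphisms_def BijGroup_def id_Bij)
next
  fix f assume f: "f \<in> graph_automorphisms G"
  then have b: "f \<in> Bij (verts G)"
    by (simp add: graph_automorphisms_def)
  let ?g = "inv_into (verts G) f"
  have g: "?g x \<in> verts G" "f (?g x) = x" if "x \<in> verts G" for x
    using b that Bij_inv_into_mem[OF b that]
    by (simp_all add: Bij_def bij_betw_def f_inv_into_f)
  have "{?g x, ?g y} \<in> edges G \<longleftrightarrow> {x, y} \<in> edges G"
    if "x \<in> verts G" "y \<in> verts G" for x y
  proof -
    have "{f (?g x), f (?g y)} \<in> edges G \<longleftrightarrow> {?g x, ?g y} \<in> edges G"
      using f g that unfolding graph_automorphisms_def by blast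
    then show ?thesis
      by (simp add: g that)
  qed
  then show "inv\<^bsub>BijGroup (verts G)\<^esub> f \<in> graph_automorphisms G"
    using b by (simp add: graph_automorphisms_def inv_BijGroup restrict_inv_into_Bij)
qed

lemma group_Aut_graph: "group (Aut_graph G)"
  by (simp add: Aut_graph_def subgroup.subgroup_is_group
      subgroup_graph_automorphisms group_BijGroup)

definition translate :: "('a \<Rightarrow> 'a) \<Rightarrow> 'a set set \<Rightarrow> 'a set set" where
  "translate f F = (\<lambda>e. f ` e) ` F"

text \<open>The partition consists of the distinct translates: elements of \<open>H\<close> that
  map \<open>F\<close> to the same edge set contribute a single block.\<close>

definition fundamental_set :: "'a ugraph \<Rightarrow> 'a set set \<Rightarrow> bool" where
  "fundamental_set G F \<longleftrightarrow>
     F \<subseteq> edges G \<and>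
     (\<exists>H. subgroup H (Aut_graph G) \<and> partition_on (edges G) ((\<lambda>f. translate f F) ` H))"

definition closed_walk_edges :: "'a list \<Rightarrow> 'a set set" where
  "closed_walk_edges c = {{c ! i, c ! (Suc i mod length c)} | i. i < length c}"

text \<open>A cycle is given by its vertices in cyclic order, the first one not repeated at the end.\<close>

definition is_cycle :: "'a ugraph \<Rightarrow> 'a list \<Rightarrow> bool" where
  "is_cycle G c \<longleftrightarrow>
     length c \<ge> 3 \<and> distinct c \<and> set c \<subseteq> verts G \<and> closed_walk_edges c \<subseteq> edges G"

definition hamiltonian_cycle :: "'a ugraph \<Rightarrow> 'a list \<Rightarrow> bool" where
  "hamiltonian_cycle G c \<longleftrightarrow> is_cycle G c \<and> set c = verts G"

end

theory Submission
  imports Defs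
begin

text \<open>
  The induction doubles the dimension, \<open>Q\<^sub>2\<^sub>n = Q\<^sub>n \<times> Q\<^sub>n\<close>. Let \<open>c\<close> be a
  Hamiltonian cycle of \<open>Q\<^sub>n\<close>, of length \<open>m\<close>, whose translates under distinct elements of \<open>H\<close> are
  disjoint and cover all edges. On the torus \<open>c \<times> c\<close> take the Hamiltonian cycle that repeatedly
  makes \<open>m - 1\<close> horizontal steps followed by one vertical step: it consists of the horizontal
  edges leaving \<open>(c\<^sub>i, c\<^sub>j)\<close> with \<open>i + j + 1 \<noteq> 0\<close> modulo \<open>m\<close> and of the vertical edges leaving
  \<open>(c\<^sub>i, c\<^sub>j)\<close> with \<open>i + j + 1 = 0\<close>. Exchanging the two coordinates therefore maps it to its
  complement in the torus, and the group generated by the diagonal action of \<open>H\<close> and this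
  exchange acts as required on \<open>Q\<^sub>2\<^sub>n\<close>.
\<close>

section \<open>Fundamental sets whose translates determine the group element\<close>

definition freely_fundamental :: "'a ugraph \<Rightarrow> 'a set set \<Rightarrow> ('a \<Rightarrow> 'a) set \<Rightarrow> bool" where
  "freely_fundamental G F H \<longleftrightarrow>
     F \<subseteq> edges G \<and> subgroup H (Aut_graph G) \<and> (\<Union>h\<in>H. translate h F) = edges G \<and>
     (\<forall>h\<in>H. \<forall>h'\<in>H. h \<noteq> h' \<longrightarrow> translate h F \<inter> translate h' F = {})"

text \<open>In \<open>fundamental_set\<close> several elements of the subgroup may give the same
  block. The free version forbids this, so that in the induction an edge determines the group
  element whose translate contains it. Nonemptiness of \<open>F\<close> keeps the empty set from
  being a block.\<close>

lemma freely_fundamental_imp_fundamental_set: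
  assumes "freely_fundamental G F H" "F \<noteq> {}"
  shows "fundamental_set G F"
proof -
  have "partition_on (edges G) ((\<lambda>f. translate f F) ` H)"
  proof (rule partition_onI)
    fix p q assume "p \<in> (\<lambda>f. translate f F) ` H" "q \<in> (\<lambda>f. translate f F) ` H" "p \<noteq> q"
    then show "disjnt p q"
      using assms(1) unfolding freely_fundamental_def disjnt_def by (elim imageE) metis
  qed (use assms in \<open>auto simp: freely_fundamental_def translate_def\<close>)
  then show ?thesis
    using assms(1) by (auto simp: freely_fundamental_def fundamental_set_def)
qed

section \<open>Operations of the automorphism group and edges of a cyclic list\<close>

lemma Aut_graph_simps [simp]:
  "carrier (Aut_graph G) = graph_automorphisms G"
  "\<one>\<^bsub>Aut_graph G\<^esub> = (\<lambda>x\<in>verts G. x)"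
  by (simp_all add: Aut_graph_def BijGroup_def)

lemma Aut_graph_mult [simp]:
  assumes "f \<in> graph_automorphisms G" "g \<in> graph_automorphisms G"
  shows "f \<otimes>\<^bsub>Aut_graph G\<^esub> g = compose (verts G) f g"
  using assms by (simp add: Aut_graph_def BijGroup_def graph_automorphisms_def)

definition cyc_edge :: "'a list \<Rightarrow> nat \<Rightarrow> 'a set" where
  "cyc_edge c i = {c ! i, c ! (Suc i mod length c)}"

lemma closed_walk_edges_eq: "closed_walk_edges c = cyc_edge c ` {..<length c}"
  by (auto simp: closed_walk_edges_def cyc_edge_def)

text \<open>If two doubletons agree crosswise, then each index is the cyclic successor of the other,
  so going two steps around returns to the start. A length of at least 3 excludes this.\<close>

lemma inj_on_cyc_edge:
  assumes "distinct c" "length c \<ge> 3"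
  shows "inj_on (cyc_edge c) {..<length c}"
proof (rule inj_onI)
  fix i j assume ij: "i \<in> {..<length c}" "j \<in> {..<length c}" "cyc_edge c i = cyc_edge c j"
  let ?s = "\<lambda>i. Suc i mod length c"
  have s: "?s i < length c" "?s j < length c"
    using ij by (auto intro: mod_less_divisor)
  from ij(3) have "i = j \<or> i = ?s j \<and> ?s i = j"
    using ij s assms(1) by (auto simp: cyc_edge_def doubleton_eq_iff nth_eq_iff_index_eq)
  then show "i = j"
    using ij assms(2) by (auto simp: mod_Suc split: if_splits)
qed

section \<open>The Cartesian square of a graph, with coordinates given by \<phi>\<close>

locale graph_square =
  fixes G :: "'a ugraph" and G' :: "'b ugraph" and \<phi> :: "'a \<times> 'a \<Rightarrow> 'b"
  assumes simple: "simple_graph G"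
    and bij: "bij_betw \<phi> (verts G \<times> verts G) (verts G')"
    and edges_square: "edges G' =
      {(\<lambda>x. \<phi> (x, b)) ` e | e b. e \<in> edges G \<and> b \<in> verts G} \<union>
      {(\<lambda>y. \<phi> (a, y)) ` e | a e. a \<in> verts G \<and> e \<in> edges G}"
begin

definition hor :: "'a set \<Rightarrow> 'a \<Rightarrow> 'b set" where "hor e b = (\<lambda>x. \<phi> (x, b)) ` e"
definition ver :: "'a set \<Rightarrow> 'a \<Rightarrow> 'b set" where "ver e a = (\<lambda>y. \<phi> (a, y)) ` e"

lemma edges_eq: "edges G' = case_prod hor ` (edges G \<times> verts G) \<union> case_prod ver ` (edges G \<times> verts G)"
  unfolding edges_square hor_def ver_def by auto

lemma hor_in: "e \<in> edges G \<Longrightarrow> b \<in> verts G \<Longrightarrow> hor e b \<in> edges G'"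
  and ver_in: "e \<in> edges G \<Longrightarrow> b \<in> verts G \<Longrightarrow> ver e b \<in> edges G'"
  unfolding edges_eq by blast+

lemma edgeD: "e \<in> edges G \<Longrightarrow> e \<subseteq> verts G" "e \<in> edges G \<Longrightarrow> card e = 2"
  using simple by (auto simp: simple_graph_def)

lemma \<phi>_eq_iff [simp]:
  assumes "a \<in> verts G" "b \<in> verts G" "a' \<in> verts G" "b' \<in> verts G"
  shows "\<phi> (a, b) = \<phi> (a', b') \<longleftrightarrow> a = a' \<and> b = b'"
  using bij assms by (auto simp: bij_betw_def dest: inj_onD)

lemma \<phi>_in [simp]: "a \<in> verts G \<Longrightarrow> b \<in> verts G \<Longrightarrow> \<phi> (a, b) \<in> verts G'"
  using bij by (auto simp: bij_betw_def)

definition proj :: "'b \<Rightarrow> 'a \<times> 'a" where "proj = inv_into (verts G \<times> verts G) \<phi>"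

lemma proj_\<phi> [simp]: "a \<in> verts G \<Longrightarrow> b \<in> verts G \<Longrightarrow> proj (\<phi> (a, b)) = (a, b)"
  using bij by (auto simp: bij_betw_def proj_def)

lemma vert_cases:
  assumes "v \<in> verts G'"
  obtains a b where "a \<in> verts G" "b \<in> verts G" "v = \<phi> (a, b)"
proof -
  have "v \<in> \<phi> ` (verts G \<times> verts G)"
    using bij assms by (simp add: bij_betw_def)
  then show thesis
    using that by auto
qed

text \<open>The two projections recover both the edge and the fixed coordinate. This is what makes
  \<open>hor\<close> and \<open>ver\<close> injective and separates their ranges.\<close>

lemma
  assumes "e \<in> edges G" "b \<in> verts G"
  shows fst_proj_hor: "(fst \<circ> proj) ` hor e b = e" and snd_proj_hor: "(snd \<circ> proj) ` hor e b = {b}"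
    and fst_proj_ver: "(fst \<circ> proj) ` ver e b = {b}" and snd_proj_ver: "(snd \<circ> proj) ` ver e b = e"
proof -
  have [simp]: "e \<noteq> {}" "x \<in> e \<Longrightarrow> x \<in> verts G" for x
    using edgeD[OF assms(1)] by auto
  show "(fst \<circ> proj) ` hor e b = e" "(snd \<circ> proj) ` hor e b = {b}"
    "(fst \<circ> proj) ` ver e b = {b}" "(snd \<circ> proj) ` ver e b = e"
    using assms(2) by (simp_all add: hor_def ver_def image_image image_constant_conv)
qed

lemma hor_eqD:
  assumes "hor e b = hor e' b'" "e \<in> edges G" "b \<in> verts G" "e' \<in> edges G" "b' \<in> verts G"
  shows "e = e'" "b = b'"
  using assms fst_proj_hor snd_proj_hor by (metis, metis singleton_inject)

lemma ver_eqD: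
  assumes "ver e b = ver e' b'" "e \<in> edges G" "b \<in> verts G" "e' \<in> edges G" "b' \<in> verts G"
  shows "e = e'" "b = b'"
  using assms snd_proj_ver fst_proj_ver by (metis, metis singleton_inject)

text \<open>The first projection of a vertical edge is a single vertex, that of a horizontal edge
  has two elements.\<close>

lemma hor_neq_ver:
  assumes "e \<in> edges G" "b \<in> verts G" "e' \<in> edges G" "b' \<in> verts G"
  shows "hor e b \<noteq> ver e' b'"
proof
  assume "hor e b = ver e' b'"
  then have "e = {b'}"
    using assms fst_proj_hor fst_proj_ver by metis
  then show False
    using assms edgeD(2)[of e] by simp
qed

text \<open>\<open>h\<close> acts diagonally, and \<open>s\<close> says whether the coordinates are
  exchanged as well. The restriction to \<open>verts G'\<close> is there because members of
  \<open>Bij\<close> are extensional functions.\<close>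

definition lift :: "('a \<Rightarrow> 'a) \<times> bool \<Rightarrow> 'b \<Rightarrow> 'b" where
  "lift = (\<lambda>(h, s). \<lambda>v\<in>verts G'. let (a, b) = proj v in if s then \<phi> (h b, h a) else \<phi> (h a, h b))"

lemma lift_\<phi> [simp]:
  assumes "a \<in> verts G" "b \<in> verts G"
  shows "lift (h, s) (\<phi> (a, b)) = (if s then \<phi> (h b, h a) else \<phi> (h a, h b))"
  using assms by (simp add: lift_def)

lemma lift_extensional: "lift p \<in> extensional (verts G')"
  by (cases p) (simp add: lift_def)

text \<open>The exchange commutes with every diagonal action and two exchanges cancel. Hence the
  Booleans add modulo 2, and \<open>lift\<close> is multiplicative on a direct product with a group
  of order two.\<close>

lemma compose_lift:
  assumes "h' \<in> verts G \<rightarrow> verts G"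
  shows "compose (verts G') (lift (h, s)) (lift (h', s')) = lift (compose (verts G) h h', s \<noteq> s')"
proof (rule extensionalityI[of _ "verts G'"])
  fix v assume "v \<in> verts G'"
  then obtain a b where ab: "a \<in> verts G" "b \<in> verts G" "v = \<phi> (a, b)"
    by (rule vert_cases)
  then have "h' a \<in> verts G" "h' b \<in> verts G"
    using assms by auto
  then show "compose (verts G') (lift (h, s)) (lift (h', s')) v = lift (compose (verts G) h h', s \<noteq> s') v"
    using ab by (simp add: compose_eq)
qed (simp_all add: lift_extensional)

lemma lift_id: "lift (\<lambda>x\<in>verts G. x, False) = (\<lambda>v\<in>verts G'. v)"
  by (rule extensionalityI[of _ "verts G'"]) (auto simp: lift_extensional elim!: vert_cases)

lemma lift_hor:
  assumes "e \<subseteq> verts G" "b \<in> verts G"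
  shows "lift (h, s) ` hor e b = (if s then ver else hor) (h ` e) (h b)"
  using assms by (force simp: hor_def ver_def image_image intro!: image_cong)

lemma lift_ver:
  assumes "e \<subseteq> verts G" "b \<in> verts G"
  shows "lift (h, s) ` ver e b = (if s then hor else ver) (h ` e) (h b)"
  using assms by (force simp: hor_def ver_def image_image intro!: image_cong)

end

section \<open>The group generated by a diagonal action and the exchange\<close>

locale automorphism_subgroup_square = graph_square +
  fixes H
  assumes sub: "subgroup H (Aut_graph G)"
begin

lemma H_aut: "h \<in> H \<Longrightarrow> h \<in> graph_automorphisms G"
  using subgroup.subset[OF sub] by auto

lemma H_Bij: "h \<in> H \<Longrightarrow> h \<in> Bij (verts G)"
  using H_aut by (auto simp: graph_automorphisms_def)

lemma H_bij_betw: "h \<in> H \<Longrightarrow> bij_betw h (verts G) (verts G)"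
  using H_Bij by (auto simp: Bij_def)

lemma H_verts: "h \<in> H \<Longrightarrow> h \<in> verts G \<rightarrow> verts G"
  using H_Bij Bij_imp_funcset by blast

lemma H_edge:
  assumes "h \<in> H" "e \<in> edges G"
  shows "h ` e \<in> edges G"
proof -
  obtain x y where "e = {x, y}"
    using edgeD(2)[OF assms(2)] by (auto simp: card_2_iff)
  with assms edgeD(1)[OF assms(2)] H_aut[OF assms(1)] show ?thesis
    by (auto simp: graph_automorphisms_def)
qed

lemma H_compose: "h \<in> H \<Longrightarrow> h' \<in> H \<Longrightarrow> compose (verts G) h h' \<in> H"
  using subgroup.m_closed[OF sub, of h h'] H_aut by simp

lemma H_inverse:
  assumes "h \<in> H"
  obtains h' where "h' \<in> H" "compose (verts G) h' h = (\<lambda>x\<in>verts G. x)"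
    "compose (verts G) h h' = (\<lambda>x\<in>verts G. x)"
proof -
  interpret A: group "Aut_graph G" by (rule group_Aut_graph)
  let ?h' = "inv\<^bsub>Aut_graph G\<^esub> h"
  have h': "?h' \<in> H"
    using subgroup.m_inv_closed[OF sub assms] .
  show thesis
    using that[OF h'] A.l_inv[of h] A.r_inv[of h] H_aut[OF assms] H_aut[OF h'] by simp
qed

lemma lift_edge:
  assumes "h \<in> H" "X \<in> edges G'"
  shows "lift (h, s) ` X \<in> edges G'"
proof -
  from assms(2) obtain e b where e: "e \<in> edges G" "b \<in> verts G" "X = hor e b \<or> X = ver e b"
    by (auto simp: edges_eq)
  have "h ` e \<in> edges G" "h b \<in> verts G"
    using H_edge H_verts assms(1) e by auto
  then show ?thesis
    using e edgeD(1)[OF e(1)] by (auto simp: lift_hor lift_ver hor_in ver_in)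
qed

text \<open>The exchange is its own inverse, so \<open>s\<close> is kept and only \<open>h\<close>
  is inverted.\<close>

lemma lift_inverse:
  assumes "h \<in> H"
  obtains h' where "h' \<in> H" "compose (verts G') (lift (h', s)) (lift (h, s)) = (\<lambda>x\<in>verts G'. x)"
    "compose (verts G') (lift (h, s)) (lift (h', s)) = (\<lambda>x\<in>verts G'. x)"
proof -
  obtain h' where h': "h' \<in> H" "compose (verts G) h' h = (\<lambda>x\<in>verts G. x)"
    "compose (verts G) h h' = (\<lambda>x\<in>verts G. x)"
    using H_inverse[OF assms] .
  show thesis
    by (rule that[OF h'(1)]) (use h' H_verts assms in \<open>simp_all add: compose_lift lift_id\<close>)
qed

lemma lift_verts: "h \<in> H \<Longrightarrow> v \<in> verts G' \<Longrightarrow> lift (h, s) v \<in> verts G'"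
  using H_verts[of h] by (auto elim!: vert_cases intro!: \<phi>_in)

lemma lift_automorphism:
  assumes h: "h \<in> H"
  shows "lift (h, s) \<in> graph_automorphisms G'"
proof -
  obtain h' where h': "h' \<in> H"
    and l: "compose (verts G') (lift (h', s)) (lift (h, s)) = (\<lambda>x\<in>verts G'. x)"
    and r: "compose (verts G') (lift (h, s)) (lift (h', s)) = (\<lambda>x\<in>verts G'. x)"
    using lift_inverse[OF h] .
  have l': "lift (h', s) (lift (h, s) v) = v" and r': "lift (h, s) (lift (h', s) v) = v"
    if "v \<in> verts G'" for v
    using fun_cong[OF l, of v] fun_cong[OF r, of v] that by (simp_all add: compose_eq)
  have "bij_betw (lift (h, s)) (verts G') (verts G')"
    by (rule bij_betwI[where g = "lift (h', s)"]) (use l' r' lift_verts h h' in auto)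
  \<comment> \<open>Reflection of adjacency is preservation of edges by the inverse map.\<close>
  moreover have "{lift (h, s) x, lift (h, s) y} \<in> edges G' \<longleftrightarrow> {x, y} \<in> edges G'"
    if "x \<in> verts G'" "y \<in> verts G'" for x y
    using lift_edge[OF h, of "{x, y}" s] lift_edge[OF h', of "{lift (h, s) x, lift (h, s) y}" s] that
    by (auto simp: l')
  ultimately show ?thesis
    by (simp add: graph_automorphisms_def Bij_def lift_extensional)
qed

lemma subgroup_lift: "subgroup (lift ` (H \<times> UNIV)) (Aut_graph G')"
proof -
  interpret A: group "Aut_graph G'" by (rule group_Aut_graph)
  show ?thesis
  proof (rule A.subgroupI)
    show "lift ` (H \<times> UNIV) \<subseteq> carrier (Aut_graph G')"
      using lift_automorphism by auto
    show "lift ` (H \<times> UNIV) \<noteq> {}"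
      using subgroup.one_closed[OF sub] by blast
  next
    fix f assume "f \<in> lift ` (H \<times> UNIV)"
    then obtain h s where h: "h \<in> H" and f: "f = lift (h, s)"
      by auto
    obtain h' where h': "h' \<in> H"
      and "compose (verts G') (lift (h', s)) (lift (h, s)) = (\<lambda>x\<in>verts G'. x)"
      using lift_inverse[OF h] .
    then have "inv\<^bsub>Aut_graph G'\<^esub> f = lift (h', s)"
      using h f by (intro A.inv_equality) (simp_all add: lift_automorphism)
    then show "inv\<^bsub>Aut_graph G'\<^esub> f \<in> lift ` (H \<times> UNIV)"
      using h' by auto
  next
    fix f g assume "f \<in> lift ` (H \<times> UNIV)" "g \<in> lift ` (H \<times> UNIV)"
    then obtain h s h' s' where "h \<in> H" "f = lift (h, s)" "h' \<in> H" "g = lift (h', s')"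
      by auto
    then show "f \<otimes>\<^bsub>Aut_graph G'\<^esub> g \<in> lift ` (H \<times> UNIV)"
      using H_compose H_verts by (auto simp: lift_automorphism compose_lift)
  qed
qed

end

section \<open>The Hamiltonian cycle on the torus and its translates\<close>

locale hamiltonian_square = automorphism_subgroup_square +
  fixes c
  assumes ham: "hamiltonian_cycle G c"
    and free: "freely_fundamental G (closed_walk_edges c) H"
begin

abbreviation m :: nat where "m \<equiv> length c"

lemma m3: "m \<ge> 3" and dist: "distinct c" and setc: "set c = verts G"
  using ham by (auto simp: hamiltonian_cycle_def is_cycle_def)

lemma c_nonempty [simp]: "c \<noteq> []"
  using m3 by auto

lemma cyc_edge_in: "i < m \<Longrightarrow> cyc_edge c i \<in> edges G"
  using free by (auto simp: freely_fundamental_def closed_walk_edges_eq)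

lemma c_in [simp]: "i < m \<Longrightarrow> c ! i \<in> verts G"
  using setc nth_mem by auto

definition steps_hor :: "nat \<Rightarrow> nat \<Rightarrow> bool" where
  "steps_hor i j \<longleftrightarrow> Suc (i + j) mod m \<noteq> 0"

text \<open>In both directions \<open>i\<close> belongs to the coordinate that moves and
  \<open>j\<close> to the one that stays fixed. A vertical edge therefore leaves the vertex with
  coordinates \<open>c ! j\<close> and \<open>c ! i\<close>, in this order. With this convention the
  exchange leaves the index pair alone and only changes the direction.\<close>

definition torus_cycle_edges :: "'b set set" where
  "torus_cycle_edges =
     (\<lambda>(i, j). (if steps_hor i j then hor else ver) (cyc_edge c i) (c ! j)) ` ({..<m} \<times> {..<m})"

text \<open>Coordinates after \<open>t\<close> steps from the origin. Every \<open>m\<close>-th step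
  is vertical, so \<open>t div m\<close> of the steps were vertical and the remaining ones
  horizontal.\<close>

definition pos :: "nat \<Rightarrow> nat \<times> nat" where
  "pos t = ((t - t div m) mod m, t div m)"

definition torus_cycle :: "'b list" where
  "torus_cycle = map (\<lambda>t. \<phi> (c ! fst (pos t), c ! snd (pos t))) [0..<m * m]"

lemma length_torus_cycle [simp]: "length torus_cycle = m * m"
  by (simp add: torus_cycle_def)

lemma pos_less:
  assumes "t < m * m"
  shows "fst (pos t) < m" "snd (pos t) < m"
  using assms by (auto simp: pos_def less_mult_imp_div_less)

text \<open>Each step raises one coordinate by one modulo \<open>m\<close>. The coordinate sum thus
  reveals \<open>t mod m\<close>, which turns \<open>steps_hor\<close> into a condition on
  \<open>t\<close> alone.\<close>

lemma pos_sum_mod: "(fst (pos t) + snd (pos t)) mod m = t mod m"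
  by (simp add: pos_def mod_simps)

text \<open>A position determines \<open>t mod m\<close> by its coordinate sum and
  \<open>t div m\<close> by its second coordinate, hence \<open>t\<close>. Surjectivity follows by
  counting.\<close>

lemma bij_pos: "bij_betw pos {..<m * m} ({..<m} \<times> {..<m})"
proof -
  have inj: "inj_on pos {..<m * m}"
  proof (rule inj_onI)
    fix t t' assume eq: "pos t = pos t'"
    then have "t mod m = t' mod m"
      using pos_sum_mod by metis
    moreover have "t div m = t' div m"
      using eq by (simp add: pos_def)
    ultimately show "t = t'"
      by (metis div_mult_mod_eq)
  qed
  have "pos ` {..<m * m} \<subseteq> {..<m} \<times> {..<m}"
    using pos_less by (simp add: image_subset_iff mem_Times_iff)
  then have "pos ` {..<m * m} = {..<m} \<times> {..<m}"
    by (intro card_subset_eq) (simp_all add: card_image[OF inj] card_cartesian_product)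
  with inj show ?thesis
    by (simp add: bij_betw_def)
qed

lemma steps_hor_pos: "pos t = (i, j) \<Longrightarrow> steps_hor i j \<longleftrightarrow> Suc t mod m \<noteq> 0"
  using pos_sum_mod[of t] by (simp add: steps_hor_def mod_Suc)

lemma pos_step:
  assumes t: "t < m * m" and ij: "pos t = (i, j)"
  shows "pos (Suc t mod (m * m)) = (if steps_hor i j then (Suc i mod m, j) else (i, Suc j mod m))"
proof -
  have i: "i = (t - t div m) mod m" and j: "j = t div m"
    using ij by (auto simp: pos_def)
  show ?thesis
  proof (cases "steps_hor i j")
    case True
    then have nz: "Suc t mod m \<noteq> 0"
      using steps_hor_pos[OF ij] by simp
    \<comment> \<open>The walk closes up at a multiple of \<open>m\<close>, so a horizontal step
      never wraps around to time 0.\<close>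
    then have "Suc t \<noteq> m * m"
      by auto
    then have "Suc t < m * m"
      using t by simp
    moreover have "Suc t div m = t div m"
      using nz by (simp add: div_Suc)
    ultimately show ?thesis
      using True by (simp add: pos_def i j Suc_diff_le mod_simps)
  next
    case False
    then have z: "Suc t mod m = 0"
      using steps_hor_pos[OF ij] by simp
    then have d: "Suc t div m = Suc (t div m)"
      by (simp add: div_Suc)
    show ?thesis
    proof (cases "Suc t = m * m")
      case True
      then have "Suc j = m"
        using d by (simp add: j)
      \<comment> \<open>At the last vertex \<open>t\<close> is \<open>m * m - 1\<close> and
        \<open>t div m\<close> is \<open>m - 1\<close>. The walk is back in column 0, and its final
        vertical step closes the cycle at the origin.\<close>
      then have "t - t div m = m * (m - 1)"
        using True by (simp add: j algebra_simps)
      then have "i = 0"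
        by (simp add: i)
      then show ?thesis
        using True \<open>Suc j = m\<close> False by (simp add: pos_def)
    next
      case neq: False
      then have less: "Suc t < m * m"
        using t by simp
      then have "Suc j < m"
        using less_mult_imp_div_less[OF less] d by (simp add: j)
      \<comment> \<open>\<open>t\<close> and its quotient both grow by one, so their difference, and
        with it the column, is unchanged.\<close>
      then show ?thesis
        using less d False by (simp add: pos_def i j)
    qed
  qed
qed

lemma torus_cycle_edge:
  assumes t: "t < m * m" and ij: "pos t = (i, j)"
  shows "cyc_edge torus_cycle t =
    (if steps_hor i j then hor (cyc_edge c i) (c ! j) else ver (cyc_edge c j) (c ! i))"
proof -
  have "Suc t mod (m * m) < m * m"
    by simp
  then show ?thesis
    using pos_step[OF t ij] t ij
    by (simp add: cyc_edge_def torus_cycle_def hor_def ver_def del: upt_Suc)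
qed

text \<open>The walk indexes an edge by the vertex that it leaves, \<open>torus_cycle_edges\<close>
  by the moving and the fixed coordinate. The two differ by swapping the indices where the step is
  vertical, and this is an involution because \<open>steps_hor\<close> is symmetric.\<close>

lemma closed_walk_edges_torus_cycle: "closed_walk_edges torus_cycle = torus_cycle_edges"
proof -
  have sym: "steps_hor i j = steps_hor j i" for i j
    by (simp add: steps_hor_def add.commute)
  let ?f = "\<lambda>(i, j). if steps_hor i j then hor (cyc_edge c i) (c ! j) else ver (cyc_edge c j) (c ! i)"
  have "closed_walk_edges torus_cycle = ?f ` pos ` {..<m * m}"
    unfolding closed_walk_edges_eq image_image length_torus_cycle
    by (rule image_cong) (auto simp: torus_cycle_edge split: prod.split)
  also have "pos ` {..<m * m} = {..<m} \<times> {..<m}"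
    using bij_pos by (simp add: bij_betw_def)
  also have "?f ` ({..<m} \<times> {..<m}) = torus_cycle_edges"
  proof -
    let ?g = "\<lambda>(i, j). (if steps_hor i j then hor else ver) (cyc_edge c i) (c ! j)"
    let ?swap = "\<lambda>(i, j). if steps_hor i j then (i, j) else (j, i)"
    have f: "?f = (\<lambda>p. ?g (?swap p))" and swap: "?swap (?swap p) = p" for p
      using sym by (auto simp: fun_eq_iff split: prod.split)
    have into: "?swap p \<in> {..<m} \<times> {..<m}" if "p \<in> {..<m} \<times> {..<m}" for p
      using that by (cases p) simp
    have "?swap ` ({..<m} \<times> {..<m}) = {..<m} \<times> {..<m}"
    proof (intro subset_antisym subsetI)
      fix p assume "p \<in> {..<m} \<times> {..<m}"
      then show "p \<in> ?swap ` ({..<m} \<times> {..<m})"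
        by (intro rev_image_eqI[of "?swap p"] into swap[symmetric])
    qed (use into in blast)
    then show ?thesis
      unfolding torus_cycle_edges_def f image_image[of ?g ?swap, symmetric] by (rule arg_cong)
  qed
  finally show ?thesis .
qed

lemma torus_cycle_edges_subset: "torus_cycle_edges \<subseteq> edges G'"
  using cyc_edge_in by (auto simp: torus_cycle_edges_def intro!: hor_in ver_in)

lemma hamiltonian_torus_cycle: "hamiltonian_cycle G' torus_cycle"
proof -
  have "bij_betw (\<lambda>i. c ! i) {..<m} (verts G)"
    using bij_betw_nth[OF dist] setc by simp
  then have "bij_betw (map_prod ((!) c) ((!) c)) ({..<m} \<times> {..<m}) (verts G \<times> verts G)"
    by (intro bij_betw_map_prod) auto
  from bij_betw_trans[OF bij_betw_trans[OF bij_pos this] bij]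
  have b: "bij_betw (\<lambda>t. \<phi> (c ! fst (pos t), c ! snd (pos t))) {..<m * m} (verts G')"
    by (simp add: o_def map_prod_def split_beta)
  have "distinct torus_cycle" "set torus_cycle = verts G'"
    using b by (simp_all add: torus_cycle_def distinct_map bij_betw_def atLeast0LessThan)
  moreover have "3 \<le> m * m"
    using m3 by (metis le_trans le_square)
  ultimately show ?thesis
    using torus_cycle_edges_subset
    by (simp add: hamiltonian_cycle_def is_cycle_def closed_walk_edges_torus_cycle)
qed

text \<open>The exchange negates the choice of direction at every index pair. So for fixed
  \<open>h\<close> the two values of \<open>s\<close> share out all edges of the torus over the
  translated cycle.\<close>

lemma translate_lift:
  assumes "h \<in> H"
  shows "translate (lift (h, s)) torus_cycle_edges =
    (\<lambda>(i, j). (if steps_hor i j \<noteq> s then hor else ver) (h ` cyc_edge c i) (h (c ! j))) `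
      ({..<m} \<times> {..<m})"
  unfolding translate_def torus_cycle_edges_def image_image
proof (intro image_cong refl)
  fix p assume "p \<in> {..<m} \<times> {..<m}"
  then obtain i j where "p = (i, j)" "i < m" "j < m"
    by auto
  with edgeD(1)[OF cyc_edge_in] show "lift (h, s) ` (case p of (i, j) \<Rightarrow>
      (if steps_hor i j then hor else ver) (cyc_edge c i) (c ! j)) =
    (case p of (i, j) \<Rightarrow> (if steps_hor i j \<noteq> s then hor else ver) (h ` cyc_edge c i) (h (c ! j)))"
    by (simp add: lift_hor lift_ver)
qed

text \<open>The translates of \<open>c\<close> cover the edges of \<open>G\<close>, so
  \<open>e\<close> supplies \<open>h\<close>. The translated cycle is again Hamiltonian, so it
  passes through \<open>b\<close>.\<close>

lemma edge_repr:
  assumes "e \<in> edges G" "b \<in> verts G"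
  obtains h i j where "h \<in> H" "i < m" "j < m" "e = h ` cyc_edge c i" "b = h (c ! j)"
proof -
  from assms(1) obtain h where h: "h \<in> H" "e \<in> translate h (closed_walk_edges c)"
    using free unfolding freely_fundamental_def by blast
  then obtain i where i: "i < m" "e = h ` cyc_edge c i"
    by (auto simp: translate_def closed_walk_edges_eq)
  have "b \<in> h ` set c"
    using assms(2) H_bij_betw[OF h(1)] setc by (simp add: bij_betw_def)
  then obtain j where "j < m" "b = h (c ! j)"
    by (auto simp: in_set_conv_nth)
  with h i show thesis
    using that by blast
qed

text \<open>Freeness identifies the group elements from the common edge. Cancelling the injective
  \<open>h\<close> then leaves an equality of edges and one of vertices of the cycle
  \<open>c\<close>.\<close>

lemma edge_repr_unique:
  assumes h: "h \<in> H" "h' \<in> H" and i: "i < m" "i' < m" and j: "j < m" "j' < m"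
    and e: "h ` cyc_edge c i = h' ` cyc_edge c i'" and b: "h (c ! j) = h' (c ! j')"
  shows "h = h'" "i = i'" "j = j'"
proof -
  have "g ` cyc_edge c l \<in> translate g (closed_walk_edges c)" if "l < m" for g l
    using that by (simp add: translate_def closed_walk_edges_eq)
  from this[OF i(1), of h] this[OF i(2), of h']
  have "h ` cyc_edge c i \<in> translate h (closed_walk_edges c) \<inter> translate h' (closed_walk_edges c)"
    by (simp add: e)
  then show [simp]: "h = h'"
    using free h unfolding freely_fundamental_def by blast
  have inj: "inj_on h (verts G)"
    using H_bij_betw[OF h(1)] by (simp add: bij_betw_def)
  have "cyc_edge c i = cyc_edge c i'"
    using inj_on_image_eq_iff[OF inj] e i edgeD(1)[OF cyc_edge_in] by simp
  then show "i = i'"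
    using inj_on_cyc_edge[OF dist m3] i by (auto dest: inj_onD)
  have "c ! j = c ! j'"
    using inj b j by (auto dest: inj_onD)
  then show "j = j'"
    using dist j by (simp add: nth_eq_iff_index_eq)
qed

lemma union_translates: "(\<Union>f\<in>lift ` (H \<times> UNIV). translate f torus_cycle_edges) = edges G'"
proof
  show "(\<Union>f\<in>lift ` (H \<times> UNIV). translate f torus_cycle_edges) \<subseteq> edges G'"
    using torus_cycle_edges_subset lift_edge by (auto simp: translate_def)
next
  show "edges G' \<subseteq> (\<Union>f\<in>lift ` (H \<times> UNIV). translate f torus_cycle_edges)"
  proof
    fix X assume "X \<in> edges G'"
    then obtain e b where e: "e \<in> edges G" "b \<in> verts G" and X: "X = hor e b \<or> X = ver e b"
      by (auto simp: edges_eq)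
    obtain h i j where h: "h \<in> H" and *: "i < m" "j < m" "e = h ` cyc_edge c i" "b = h (c ! j)"
      using edge_repr[OF e] .
    \<comment> \<open>For the given index pair exactly one value of \<open>s\<close> selects the
      direction of \<open>X\<close>.\<close>
    have "\<exists>s. X \<in> translate (lift (h, s)) torus_cycle_edges"
      using X
    proof
      assume "X = hor e b"
      then show ?thesis
        using * by (intro exI[of _ "\<not> steps_hor i j"]) (force simp: translate_lift[OF h] image_iff)
    next
      assume "X = ver e b"
      then show ?thesis
        using * by (intro exI[of _ "steps_hor i j"]) (force simp: translate_lift[OF h] image_iff)
    qed
    then show "X \<in> (\<Union>f\<in>lift ` (H \<times> UNIV). translate f torus_cycle_edges)"
      using h by blast
  qed
qed

text \<open>A common edge has one direction, one underlying edge and one fixed vertex. The last two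
  determine \<open>h\<close>, \<open>i\<close> and \<open>j\<close>; then \<open>steps_hor\<close>
  has the same value on both sides, and the direction determines \<open>s\<close>.\<close>

lemma disjoint_translates:
  assumes h: "h \<in> H" "h' \<in> H"
    and X: "X \<in> translate (lift (h, s)) torus_cycle_edges"
      "X \<in> translate (lift (h', s')) torus_cycle_edges"
  shows "(h, s) = (h', s')"
proof -
  have in_G: "g ` cyc_edge c i \<in> edges G" "g (c ! i) \<in> verts G" if "g \<in> H" "i < m" for g i
    using that H_edge cyc_edge_in H_verts[of g] by auto
  obtain i j where ij: "i < m" "j < m"
    and 1: "X = (if steps_hor i j \<noteq> s then hor else ver) (h ` cyc_edge c i) (h (c ! j))"
    using X(1) unfolding translate_lift[OF h(1)] by auto
  obtain i' j' where ij': "i' < m" "j' < m"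
    and 2: "X = (if steps_hor i' j' \<noteq> s' then hor else ver) (h' ` cyc_edge c i') (h' (c ! j'))"
    using X(2) unfolding translate_lift[OF h(2)] by auto
  note G = in_G[OF h(1) ij(1)] in_G[OF h(1) ij(2)] in_G[OF h(2) ij'(1)] in_G[OF h(2) ij'(2)]
  have *: "h ` cyc_edge c i = h' ` cyc_edge c i' \<and> h (c ! j) = h' (c ! j') \<and>
      (steps_hor i j = s \<longleftrightarrow> steps_hor i' j' = s')"
    using 1 2 G by (auto split: if_splits dest: hor_eqD ver_eqD simp: hor_neq_ver hor_neq_ver[symmetric])
  with edge_repr_unique[OF h ij(1) ij'(1) ij(2) ij'(2)] show ?thesis
    by auto
qed

lemma freely_fundamental_torus_cycle:
  "freely_fundamental G' (closed_walk_edges torus_cycle) (lift ` (H \<times> UNIV))"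
proof -
  have "translate f torus_cycle_edges \<inter> translate g torus_cycle_edges = {}"
    if fg: "f \<in> lift ` (H \<times> UNIV)" "g \<in> lift ` (H \<times> UNIV)" "f \<noteq> g" for f g
  proof -
    from fg obtain h s h' s' where "h \<in> H" "h' \<in> H" "f = lift (h, s)" "g = lift (h', s')"
      by auto
    with \<open>f \<noteq> g\<close> show ?thesis
      using disjoint_translates[of h h' _ s s'] by auto
  qed
  then show ?thesis
    using subgroup_lift union_translates torus_cycle_edges_subset
    unfolding freely_fundamental_def closed_walk_edges_torus_cycle by blast
qed

end

section \<open>The hypercube of doubled dimension as a Cartesian square\<close>

definition join_sets :: "nat \<Rightarrow> nat set \<times> nat set \<Rightarrow> nat set" where
  "join_sets n = (\<lambda>(A, B). A \<union> (+) n ` B)"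

lemma bij_betw_join:
  "bij_betw (join_sets n) (Pow {1..n} \<times> Pow {1..n}) (Pow {1..2 * n})"
proof (rule bij_betwI[where g = "\<lambda>C. (C \<inter> {1..n}, {x \<in> {1..n}. n + x \<in> C})"])
  show "join_sets n \<in> Pow {1..n} \<times> Pow {1..n} \<rightarrow> Pow {1..2 * n}"
    by (force simp: join_sets_def)
  show "join_sets n (C \<inter> {1..n}, {x \<in> {1..n}. n + x \<in> C}) = C" if "C \<in> Pow {1..2 * n}" for C
  proof -
    have "x \<in> (+) n ` {x \<in> {1..n}. n + x \<in> C}" if "x \<in> C" "\<not> x \<le> n" for x
      using that \<open>C \<in> Pow {1..2 * n}\<close> by (intro rev_image_eqI[of "x - n"]) auto
    then show ?thesis
      using that by (force simp: join_sets_def)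
  qed
qed (auto simp: join_sets_def)

text \<open>The halves live on disjoint ranges of numbers, so Hamming distance is additive over
  them.\<close>

lemma card_sym_diff_join:
  assumes "A \<subseteq> {1..n}" "A' \<subseteq> {1..n}" "B \<subseteq> {1..n}" "B' \<subseteq> {1..n}"
  shows "card (sym_diff (join_sets n (A, B)) (join_sets n (A', B'))) =
    card (sym_diff A A') + card (sym_diff B B')"
proof -
  have disj: "A - (+) n ` B' = A" "A' - (+) n ` B = A'" "(+) n ` B - A' = (+) n ` B"
    "(+) n ` B' - A = (+) n ` B'"
    using assms by fastforce+
  have "sym_diff (join_sets n (A, B)) (join_sets n (A', B')) =
      sym_diff A A' \<union> sym_diff ((+) n ` B) ((+) n ` B')"
    using disj unfolding join_sets_def prod.case by blast
  also have "sym_diff ((+) n ` B) ((+) n ` B') = (+) n ` sym_diff B B'"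
    by (simp add: image_Un image_set_diff)
  finally have "sym_diff (join_sets n (A, B)) (join_sets n (A', B')) =
      sym_diff A A' \<union> (+) n ` sym_diff B B'" .
  moreover have "sym_diff A A' \<inter> (+) n ` sym_diff B B' = {}"
    using assms by fastforce
  moreover have "finite (sym_diff A A')" "finite (sym_diff B B')"
    using assms finite_subset[OF _ finite_atLeastAtMost] by (meson finite_Diff finite_UnI)+
  ultimately show ?thesis
    by (simp add: card_Un_disjoint card_image)
qed

lemma edge_hypercube_iff:
  "e \<in> edges (hypercube n) \<longleftrightarrow>
    (\<exists>x y. e = {x, y} \<and> x \<subseteq> {1..n} \<and> y \<subseteq> {1..n} \<and> card (sym_diff x y) = 1)"
  by (auto simp: hypercube_def)

lemma verts_hypercube [simp]: "verts (hypercube n) = Pow {1..n}"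
  by (simp add: hypercube_def)

text \<open>By additivity, distance 1 means distance 1 in one half and 0 in the other.\<close>

lemma graph_square_hypercube: "graph_square (hypercube n) (hypercube (2 * n)) (join_sets n)"
proof
  show "simple_graph (hypercube n)"
    by (rule simple_graph_hypercube)
  show "bij_betw (join_sets n) (verts (hypercube n) \<times> verts (hypercube n)) (verts (hypercube (2 * n)))"
    using bij_betw_join by simp
  have surj: "\<exists>A B. A \<subseteq> {1..n} \<and> B \<subseteq> {1..n} \<and> x = join_sets n (A, B)" if "x \<subseteq> {1..2 * n}" for x
  proof -
    have "x \<in> join_sets n ` (Pow {1..n} \<times> Pow {1..n})"
      using that bij_betw_join[of n] by (simp add: bij_betw_def)
    then show ?thesis
      by auto
  qed
  have into: "join_sets n (A, B) \<subseteq> {1..2 * n}" if "A \<subseteq> {1..n}" "B \<subseteq> {1..n}" for A B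
    using bij_betwE[OF bij_betw_join[of n]] that by blast
  show "edges (hypercube (2 * n)) =
      {(\<lambda>x. join_sets n (x, b)) ` e | e b. e \<in> edges (hypercube n) \<and> b \<in> verts (hypercube n)} \<union>
      {(\<lambda>y. join_sets n (a, y)) ` e | a e. a \<in> verts (hypercube n) \<and> e \<in> edges (hypercube n)}"
    (is "_ = ?R")
  proof (intro subset_antisym subsetI)
    fix X assume "X \<in> edges (hypercube (2 * n))"
    then obtain x y where X: "X = {x, y}" "x \<subseteq> {1..2 * n}" "y \<subseteq> {1..2 * n}" "card (sym_diff x y) = 1"
      by (auto simp: edge_hypercube_iff)
    obtain A B where A: "A \<subseteq> {1..n}" "B \<subseteq> {1..n}" "x = join_sets n (A, B)"
      using surj[OF X(2)] by blast
    obtain A' B' where A': "A' \<subseteq> {1..n}" "B' \<subseteq> {1..n}" "y = join_sets n (A', B')"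
      using surj[OF X(3)] by blast
    \<comment> \<open>Infinite sets also have \<open>card\<close> 0, so finiteness is what turns
      distance 0 into equality of the halves.\<close>
    have fin: "finite (sym_diff A A')" "finite (sym_diff B B')"
      using A A' finite_subset[OF _ finite_atLeastAtMost] by (meson finite_Diff finite_UnI)+
    have "card (sym_diff A A') + card (sym_diff B B') = 1"
      using X(4) A A' card_sym_diff_join[of A n A' B B'] by simp
    then consider "card (sym_diff A A') = 1" "B = B'" | "card (sym_diff B B') = 1" "A = A'"
      using fin by (auto simp: add_is_1)
    then show "X \<in> ?R"
    proof cases
      case 1
      then have "{A, A'} \<in> edges (hypercube n)" "X = (\<lambda>x. join_sets n (x, B)) ` {A, A'}"
        using A A' X(1) by (auto simp: edge_hypercube_iff)
      then show ?thesis
        using A by auto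
    next
      case 2
      then have "{B, B'} \<in> edges (hypercube n)" "X = (\<lambda>y. join_sets n (A, y)) ` {B, B'}"
        using A A' X(1) by (auto simp: edge_hypercube_iff)
      then show ?thesis
        using A by auto
    qed
  next
    fix X assume "X \<in> ?R"
    then consider e b where "e \<in> edges (hypercube n)" "b \<subseteq> {1..n}" "X = (\<lambda>x. join_sets n (x, b)) ` e"
      | e a where "e \<in> edges (hypercube n)" "a \<subseteq> {1..n}" "X = (\<lambda>y. join_sets n (a, y)) ` e"
      by auto
    then show "X \<in> edges (hypercube (2 * n))"
    proof cases
      case 1
      then obtain x y where "e = {x, y}" "x \<subseteq> {1..n}" "y \<subseteq> {1..n}" "card (sym_diff x y) = 1"
        by (auto simp: edge_hypercube_iff)
      with 1 have "X = {join_sets n (x, b), join_sets n (y, b)}"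
        "card (sym_diff (join_sets n (x, b)) (join_sets n (y, b))) = 1"
        "join_sets n (x, b) \<subseteq> {1..2 * n}" "join_sets n (y, b) \<subseteq> {1..2 * n}"
        by (simp_all only: card_sym_diff_join into image_insert image_empty) simp_all
      then show ?thesis
        unfolding edge_hypercube_iff by blast
    next
      case 2
      then obtain x y where "e = {x, y}" "x \<subseteq> {1..n}" "y \<subseteq> {1..n}" "card (sym_diff x y) = 1"
        by (auto simp: edge_hypercube_iff)
      with 2 have "X = {join_sets n (a, x), join_sets n (a, y)}"
        "card (sym_diff (join_sets n (a, x)) (join_sets n (a, y))) = 1"
        "join_sets n (a, x) \<subseteq> {1..2 * n}" "join_sets n (a, y) \<subseteq> {1..2 * n}"
        by (simp_all only: card_sym_diff_join into image_insert image_empty) simp_all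
      then show ?thesis
        unfolding edge_hypercube_iff by blast
    qed
  qed
qed

section \<open>The base case in dimension 2 and the induction\<close>

lemma hypercube_2:
  defines "c \<equiv> [{}, {1}, {1, 2}, {2::nat}]"
  shows "hamiltonian_cycle (hypercube 2) c"
    and "freely_fundamental (hypercube 2) (closed_walk_edges c) {\<lambda>x\<in>Pow {1..2}. x}"
proof -
  have iv: "{1..2} = {1, 2::nat}"
    by auto
  have cw: "closed_walk_edges c = {{{}, {1}}, {{1}, {1, 2}}, {{1, 2}, {2}}, {{2}, {}}}"
  proof -
    have "{..<length c} = {0, 1, 2, 3}"
      by (auto simp: c_def)
    then show ?thesis
      unfolding closed_walk_edges_eq by (simp add: cyc_edge_def) (simp add: c_def)
  qed
  \<comment> \<open>This square is itself a 4-cycle: the Hamiltonian cycle uses every edge, so the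
    trivial group suffices.\<close>
  have edges: "edges (hypercube 2) = closed_walk_edges c"
  proof (intro subset_antisym subsetI)
    fix e assume "e \<in> edges (hypercube 2)"
    then obtain x y where "e = {x, y}" "x \<in> Pow {1, 2}" "y \<in> Pow {1, 2}" "card (sym_diff x y) = 1"
      unfolding edge_hypercube_iff iv by blast
    then show "e \<in> closed_walk_edges c"
      unfolding cw Pow_insert Pow_empty by (auto simp: doubleton_eq_iff)
  next
    have "{x, y} \<in> edges (hypercube 2)"
      if "x \<subseteq> {1, 2}" "y \<subseteq> {1, 2}" "card (sym_diff x y) = 1" for x y
      using that unfolding edge_hypercube_iff iv by blast
    moreover fix e assume "e \<in> closed_walk_edges c"
    ultimately show "e \<in> edges (hypercube 2)"
      unfolding cw by auto
  qed
  show "hamiltonian_cycle (hypercube 2) c"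
    unfolding hamiltonian_cycle_def is_cycle_def edges verts_hypercube iv Pow_insert
    by (auto simp: c_def)
  interpret A: group "Aut_graph (hypercube 2)" by (rule group_Aut_graph)
  have "translate (\<lambda>x\<in>Pow {1..2}. x) (closed_walk_edges c) = closed_walk_edges c"
  proof -
    have "(\<lambda>x\<in>Pow {1..2}. x) ` e = e" if "e \<in> edges (hypercube 2)" for e
      using that by (auto simp: edge_hypercube_iff)
    then show ?thesis
      unfolding translate_def edges[symmetric] by simp
  qed
  moreover have "subgroup {\<lambda>x\<in>Pow {1..2}. x} (Aut_graph (hypercube 2))"
    using A.triv_subgroup by simp
  ultimately show "freely_fundamental (hypercube 2) (closed_walk_edges c) {\<lambda>x\<in>Pow {1..2}. x}"
    by (simp add: freely_fundamental_def edges)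
qed

lemma hypercube_freely_fundamental:
  assumes "k \<ge> 1"
  shows "\<exists>c H. hamiltonian_cycle (hypercube (2 ^ k)) c \<and>
    freely_fundamental (hypercube (2 ^ k)) (closed_walk_edges c) H"
  using assms
proof (induction k rule: nat_induct_at_least)
  \<comment> \<open>The induction starts in dimension 2, since \<open>hypercube 1\<close> is a
    single edge and has no cycle.\<close>
  case base
  then show ?case
    using hypercube_2 by (metis power_one_right)
next
  case (Suc k)
  then obtain c H where c: "hamiltonian_cycle (hypercube (2 ^ k)) c"
    and H: "freely_fundamental (hypercube (2 ^ k)) (closed_walk_edges c) H"
    by blast
  interpret graph_square "hypercube (2 ^ k)" "hypercube (2 ^ Suc k)" "join_sets (2 ^ k)"
    using graph_square_hypercube[of "2 ^ k"] by simp
  interpret hamiltonian_square "hypercube (2 ^ k)" "hypercube (2 ^ Suc k)" "join_sets (2 ^ k)" H c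
    by (intro hamiltonian_square.intro automorphism_subgroup_square.intro
        automorphism_subgroup_square_axioms.intro hamiltonian_square_axioms.intro graph_square_axioms c H)
      (use H in \<open>simp add: freely_fundamental_def\<close>)
  show ?case
    using hamiltonian_torus_cycle freely_fundamental_torus_cycle by blast
qed

theorem theorem3:
  fixes k :: nat
  assumes "k \<ge> 1"
  shows "\<exists>c. hamiltonian_cycle (hypercube (2 ^ k)) c \<and>
             fundamental_set (hypercube (2 ^ k)) (closed_walk_edges c)"
proof -
  obtain c H where c: "hamiltonian_cycle (hypercube (2 ^ k)) c"
    and H: "freely_fundamental (hypercube (2 ^ k)) (closed_walk_edges c) H"
    using hypercube_freely_fundamental[OF assms] by blast
  have "closed_walk_edges c \<noteq> {}"
    using c by (auto simp: closed_walk_edges_eq hamiltonian_cycle_def is_cycle_def lessThan_empty_iff)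
  with c H show ?thesis
    using freely_fundamental_imp_fundamental_set by blast
qed

end
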